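(* Let $N\ge 1$, let $\bm x=(x_1,\dots,x_N)$ satisfy $0<x_1\le x_2\le\dots\le x_N$ and let $\bm w=(w_1,\dots,w_N)$ satisfy $w_i>0$ for all $i$. Let $Q=(q_{i,j})_{i,j=1,\dots,N}\in\mathbb R^{N\times N}$ be the matrix given by $q_{i,j}=w_j$ for $1\le j\le i\le N$, $q_{i,i+1}=-\sum_{j=1}^i w_j$ for $i=1,\dots,N-1$, and $q_{i,j}=0$ for all other pairs $(i,j)$. Then $Q$ is admissible (with respect to $\bm x$ and $\bm w$). In particular, the set $\mathcal Q$ of all admissible matrices is nonempty.
   Context: Notation: $\bm e_i\in\mathbb R^N$ is the $i$-th unit (column) vector, $\bm 1=(1,\dots,1)^\top\in\mathbb R^N$, $\overline w=\bm w^\top\bm 1=\sum_{i=1}^N w_i$, and $\mathrm{diag}(\bm x)$ is the diagonal matrix with diagonal entries $x_1,\dots,x_N$. Definition (admissible matrix). A matrix $Q\in\mathbb R^{N\times N}$ is called admissible (with respect to $\bm x$, $\bm w$) if: (1) $Q$ is invertible; (2) $\bm e_N^\top Q=\bm w^\top$; (3) $Q\bm 1=\overline w\,\bm e_N$; (4) $(Q\,\mathrm{diag}(\bm x)Q^{-1})_{i,j}\le 0$ for all $i,j\in\{1,\dots,N\}$ with $i\ne j$. The set of all admissible matrices is denoted $\mathcal Q$. *)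

theory Defs
  imports "Jordan_Normal_Form.Gauss_Jordan_Elimination"
begin

(* Vectors and matrices of the library are indexed from 0: the mathematical index i in 1..N is
   the index i - 1 here. In particular e_N is unit_vec N (N - 1). *)

definition ones_vec :: "nat \<Rightarrow> real vec" where
  "ones_vec N = vec N (\<lambda>_. 1)"

definition total_weight :: "real vec \<Rightarrow> real" where
  "total_weight w = w \<bullet> ones_vec (dim_vec w)"

(* The inverse of Q is the (mat_inverse Q); it is used only in conjunction with
   invertible_mat Q, where mat_inverse Q is not None. *)
definition admissible_matrix :: "nat \<Rightarrow> real vec \<Rightarrow> real vec \<Rightarrow> real mat \<Rightarrow> bool" where
  "admissible_matrix N x w Q \<longleftrightarrow>
     Q \<in> carrier_mat N N \<and>
     invertible_mat Q \<and>
     mat_of_row (unit_vec N (N - 1)) * Q = mat_of_row w \<and>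
     Q *\<^sub>v ones_vec N = total_weight w \<cdot>\<^sub>v unit_vec N (N - 1) \<and>
     (\<forall>i<N. \<forall>j<N. i \<noteq> j \<longrightarrow>
        (Q * mat_diag N (\<lambda>k. x $ k) * the (mat_inverse Q)) $$ (i, j) \<le> 0)"

definition admissible_matrices :: "nat \<Rightarrow> real vec \<Rightarrow> real vec \<Rightarrow> real mat set" where
  "admissible_matrices N x w = {Q. admissible_matrix N x w Q}"

(* In 1-based indices: q(i,j) = w_j for j <= i, q(i,i+1) = -(w_1 + ... + w_i), and 0 otherwise. *)
definition Q_matrix :: "nat \<Rightarrow> real vec \<Rightarrow> real mat" where
  "Q_matrix N w = mat N N (\<lambda>(i, j).
     if j \<le> i then w $ j
     else if j = Suc i then - (\<Sum>k\<le>i. w $ k)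
     else 0)"

end

theory Submission
  imports Defs "Jordan_Normal_Form.Determinant"
begin

text \<open>
  The proof rests on the observation that the rows of \<open>Q\<close> are pairwise orthogonal for the inner
  product with weights \<open>1 / w\<^sub>k\<close>. More generally, for rows \<open>i < j\<close> and any vector \<open>y\<close>,
  \<open>(\<Sum>k. q\<^sub>i\<^sub>k q\<^sub>j\<^sub>k y\<^sub>k / w\<^sub>k) = (\<Sum>k\<le>i. w\<^sub>k (y\<^sub>k - y\<^sub>i\<^sub>+\<^sub>1))\<close>,
  because row \<open>j\<close> agrees with \<open>w\<close> on the whole support of row \<open>i\<close>
  (\<open>Q_matrix_weighted_row_product\<close>).

  Taking \<open>y = 1\<close> gives orthogonality, so \<open>Q\<close> is inverted by its weighted transpose once each
  column is divided by the squared norm of the corresponding row (\<open>Q_matrix_times_right_inverse\<close>).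
  With this inverse, each off-diagonal entry of \<open>Q diag(x) Q\<^sup>-\<^sup>1\<close> is, up to a positive
  factor, the sum above for \<open>y = x\<close>, and this is nonpositive because \<open>x\<close> is nondecreasing; entries
  below the diagonal reduce to those above it since the sum is symmetric in the two rows.

  The conditions on the last row and on the row sums come from the shape of \<open>Q\<close>: the last row has
  no superdiagonal entry, so it is \<open>w\<close>, and in every other row that entry cancels the rest.
\<close>

lemma Q_matrix_carrier: "Q_matrix N w \<in> carrier_mat N N"
  by (simp add: Q_matrix_def)

lemma dim_Q_matrix [simp]: "dim_row (Q_matrix N w) = N" "dim_col (Q_matrix N w) = N"
  by (simp_all add: Q_matrix_def)

lemma Q_matrix_index:
  assumes "i < N" "j < N"
  shows "Q_matrix N w $$ (i, j) =
    (if j \<le> i then w $ j else if j = Suc i then - (\<Sum>k\<le>i. w $ k) else 0)"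
  using assms by (simp add: Q_matrix_def)

lemma Q_matrix_row_sum:
  fixes f :: "nat \<Rightarrow> real"
  assumes "i < N"
  shows "(\<Sum>k<N. Q_matrix N w $$ (i, k) * f k) =
    (\<Sum>k\<le>i. w $ k * f k) - (if Suc i < N then (\<Sum>k\<le>i. w $ k) * f (Suc i) else 0)"
proof -
  let ?g = "\<lambda>k. if k \<le> i then w $ k * f k else 0"
  let ?h = "\<lambda>k. if k = Suc i then - (\<Sum>k\<le>i. w $ k) * f (Suc i) else 0"
  have "(\<Sum>k<N. Q_matrix N w $$ (i, k) * f k) = (\<Sum>k<N. ?g k + ?h k)"
    by (rule sum.cong) (auto simp: Q_matrix_index assms)
  also have "\<dots> = (\<Sum>k<N. ?g k) + (\<Sum>k<N. ?h k)"
    by (rule sum.distrib)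
  also have "(\<Sum>k<N. ?g k) = (\<Sum>k\<le>i. w $ k * f k)"
    by (rule sum.mono_neutral_cong_right) (use assms in auto)
  also have "(\<Sum>k<N. ?h k) = - (if Suc i < N then (\<Sum>k\<le>i. w $ k) * f (Suc i) else 0)"
    by simp
  finally show ?thesis by simp
qed

lemma Q_matrix_weighted_row_product:
  assumes "\<And>k. k < N \<Longrightarrow> 0 < w $ k" and "i < j" "j < N"
  shows "(\<Sum>k<N. Q_matrix N w $$ (i, k) * (Q_matrix N w $$ (j, k) * (y k / w $ k))) =
    (\<Sum>k\<le>i. w $ k * (y k - y (Suc i)))"
proof -
  have row_j: "Q_matrix N w $$ (j, k) * (y k / w $ k) = y k" if "k \<le> Suc i" for k
  proof -
    have "k < N" "k \<le> j" using assms(2,3) that by simp_all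
    with assms(1)[of k] assms(3) show ?thesis by (simp add: Q_matrix_index)
  qed
  have "(\<Sum>k<N. Q_matrix N w $$ (i, k) * (Q_matrix N w $$ (j, k) * (y k / w $ k))) =
      (\<Sum>k\<le>i. w $ k * y k) - (\<Sum>k\<le>i. w $ k) * y (Suc i)"
    using assms by (subst Q_matrix_row_sum) (simp_all add: row_j del: times_divide_eq_right)
  also have "\<dots> = (\<Sum>k\<le>i. w $ k * (y k - y (Suc i)))"
    by (simp add: algebra_simps sum_subtractf sum_distrib_left)
  finally show ?thesis .
qed

definition row_norm2 :: "nat \<Rightarrow> real vec \<Rightarrow> nat \<Rightarrow> real" where
  "row_norm2 N w j = (\<Sum>k<N. Q_matrix N w $$ (j, k) * (Q_matrix N w $$ (j, k) / w $ k))"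

lemma row_norm2_pos:
  assumes "\<And>k. k < N \<Longrightarrow> 0 < w $ k" and "j < N"
  shows "0 < row_norm2 N w j"
  unfolding row_norm2_def
proof (rule sum_pos2[where i = j])
  show "0 < Q_matrix N w $$ (j, j) * (Q_matrix N w $$ (j, j) / w $ j)"
    using assms(1)[OF assms(2)] assms(2) by (simp add: Q_matrix_index)
  show "0 \<le> Q_matrix N w $$ (j, k) * (Q_matrix N w $$ (j, k) / w $ k)" if "k \<in> {..<N}" for k
    using assms(1)[of k] that by simp
qed (use assms in auto)

definition Q_inverse :: "nat \<Rightarrow> real vec \<Rightarrow> real mat" where
  "Q_inverse N w = mat N N (\<lambda>(k, j). Q_matrix N w $$ (j, k) / w $ k / row_norm2 N w j)"

lemma Q_inverse_carrier: "Q_inverse N w \<in> carrier_mat N N"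
  by (simp add: Q_inverse_def)

text \<open>
  Both \<open>Q Q\<^sup>-\<^sup>1 = 1\<close> (the case \<open>x = 1\<close>) and the sign condition are read off from this formula,
  so \<open>Q_inverse\<close> is kept here as a bare formula, without using that it inverts \<open>Q\<close>.
\<close>

lemma Q_diag_Q_inverse_index:
  assumes "i < N" "j < N"
  shows "(Q_matrix N w * mat_diag N x * Q_inverse N w) $$ (i, j) =
    (\<Sum>k<N. Q_matrix N w $$ (i, k) * (Q_matrix N w $$ (j, k) * (x k / w $ k))) / row_norm2 N w j"
  using assms
  by (auto simp: mat_diag_mult_right[OF Q_matrix_carrier] Q_inverse_def scalar_prod_def
      sum_divide_distrib atLeast0LessThan mult_ac intro!: sum.cong)

lemma Q_matrix_times_right_inverse:
  assumes pos: "\<And>k. k < N \<Longrightarrow> 0 < w $ k"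
  shows "Q_matrix N w * Q_inverse N w = 1\<^sub>m N"
proof (rule eq_matI)
  fix i j assume "i < dim_row (1\<^sub>m N :: real mat)" "j < dim_col (1\<^sub>m N :: real mat)"
  then have ij: "i < N" "j < N" by simp_all
  let ?s = "\<lambda>i j. \<Sum>k<N. Q_matrix N w $$ (i, k) * (Q_matrix N w $$ (j, k) * (1 / w $ k))"
  have "(Q_matrix N w * Q_inverse N w) $$ (i, j) = ?s i j / row_norm2 N w j"
    using Q_diag_Q_inverse_index[OF ij, of w "\<lambda>_. 1"]
    by (simp add: mat_diag_one right_mult_one_mat[OF Q_matrix_carrier])
  also have "?s i j = (if i = j then row_norm2 N w j else 0)"
  proof (cases i j rule: linorder_cases)
    case less
    then show ?thesis using Q_matrix_weighted_row_product[OF pos less ij(2), where y = "\<lambda>_. 1"] by simp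
  next
    case equal
    then show ?thesis by (simp add: row_norm2_def)
  next
    case greater
    then have "?s j i = 0"
      using Q_matrix_weighted_row_product[OF pos greater ij(1), where y = "\<lambda>_. 1"] by simp
    then show ?thesis using greater by (simp add: mult.commute)
  qed
  finally show "(Q_matrix N w * Q_inverse N w) $$ (i, j) = 1\<^sub>m N $$ (i, j)"
    using row_norm2_pos[OF pos ij(2)] ij by simp
qed (simp_all add: Q_inverse_def)

text \<open>
  Over a field a right inverse of a square matrix is two-sided. So \<open>A\<close> is a unit of the matrix ring,
  which means that Gauss-Jordan elimination succeeds, and its result is \<open>B\<close> by uniqueness of inverses.
\<close>

lemma mat_inverse_eq_right_inverse:
  fixes A B :: "'a :: field mat"
  assumes A: "A \<in> carrier_mat n n" and B: "B \<in> carrier_mat n n" and AB: "A * B = 1\<^sub>m n"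
  shows "mat_inverse A = Some B"
proof (cases "mat_inverse A")
  case None
  have "B * A = 1\<^sub>m n" by (rule mat_mult_left_right_inverse[OF A B AB])
  then have "A \<in> Units (ring_mat TYPE('a) n ())"
    using A B AB by (auto simp: Units_def ring_mat_def)
  with mat_inverse(1)[OF A None, of "()"] show ?thesis by blast
next
  case (Some C)
  then have "C * A = 1\<^sub>m n" and C: "C \<in> carrier_mat n n"
    using mat_inverse(2)[OF A Some] by auto
  then have "C = B"
    using assoc_mult_mat[OF C A B] AB left_mult_one_mat[OF B] right_mult_one_mat[OF C] by simp
  with Some show ?thesis by simp
qed

lemma weighted_row_product_nonpos:
  assumes pos: "\<And>k. k < N \<Longrightarrow> 0 < w $ k" and mono: "\<And>i. Suc i < N \<Longrightarrow> x $ i \<le> x $ Suc i"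
    and "i < j" "j < N"
  shows "(\<Sum>k<N. Q_matrix N w $$ (i, k) * (Q_matrix N w $$ (j, k) * (x $ k / w $ k))) \<le> 0"
proof -
  have incr: "x $ k \<le> x $ m" if "k \<le> m" "m < N" for k m
    using that by (induction m rule: dec_induct) (use mono in force)+
  have "w $ k * (x $ k - x $ Suc i) \<le> 0" if "k \<le> i" for k
    using incr[of k "Suc i"] pos[of k] that assms(3,4)
    by (simp add: mult_nonneg_nonpos less_imp_le)
  then show ?thesis
    using Q_matrix_weighted_row_product[OF pos assms(3,4), where y = "\<lambda>k. x $ k"]
    by (auto intro: sum_nonpos)
qed

theorem theorem2p2:
  fixes N :: nat and x w :: "real vec"
  assumes "N \<ge> 1"
    and "x \<in> carrier_vec N"
    and "w \<in> carrier_vec N"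
    and "0 < x $ 0"
    and "\<And>i. Suc i < N \<Longrightarrow> x $ i \<le> x $ Suc i"
    and "\<And>i. i < N \<Longrightarrow> 0 < w $ i"
  shows "admissible_matrix N x w (Q_matrix N w) \<and> admissible_matrices N x w \<noteq> {}"
proof -
  note pos = assms(6) and mono = assms(5)
  let ?Q = "Q_matrix N w"
  have dim_w: "dim_vec w = N" using assms(3) by simp
  have inv: "?Q * Q_inverse N w = 1\<^sub>m N" by (rule Q_matrix_times_right_inverse[OF pos])
  have inv': "Q_inverse N w * ?Q = 1\<^sub>m N"
    by (rule mat_mult_left_right_inverse[OF Q_matrix_carrier Q_inverse_carrier inv])
  have "invertible_mat ?Q"
    using inv inv' unfolding invertible_mat_def inverts_mat_def
    by (auto intro!: exI[of _ "Q_inverse N w"] simp: Q_inverse_def)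
  moreover have "mat_of_row (unit_vec N (N - 1)) * ?Q = mat_of_row w"
  proof (rule eq_matI)
    fix i j assume "i < dim_row (mat_of_row w)" "j < dim_col (mat_of_row w)"
    then have i: "i = 0" and j: "j < N" using dim_w by simp_all
    have "col ?Q j \<in> carrier_vec N" using col_dim[of ?Q j] by simp
    then have "unit_vec N (N - 1) \<bullet> col ?Q j = col ?Q j $ (N - 1)"
      by (rule scalar_prod_left_unit) (use assms(1) in simp)
    also have "\<dots> = w $ j" using j by (simp add: Q_matrix_index) linarith
    finally show "(mat_of_row (unit_vec N (N - 1)) * ?Q) $$ (i, j) = mat_of_row w $$ (i, j)"
      using i j dim_w by simp
  qed (simp_all add: dim_w)
  moreover have "?Q *\<^sub>v ones_vec N = total_weight w \<cdot>\<^sub>v unit_vec N (N - 1)"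
  proof (rule eq_vecI)
    fix i assume "i < dim_vec (total_weight w \<cdot>\<^sub>v unit_vec N (N - 1))"
    then have i: "i < N" by simp
    have "(?Q *\<^sub>v ones_vec N) $ i = (\<Sum>k<N. ?Q $$ (i, k) * 1)"
      using i by (simp add: scalar_prod_def ones_vec_def atLeast0LessThan)
    also have "\<dots> = (if Suc i < N then 0 else (\<Sum>k\<le>i. w $ k))"
      by (subst Q_matrix_row_sum[OF i]) simp
    also have "\<dots> = (if i = N - 1 then total_weight w else 0)"
    proof (cases "Suc i < N")
      case False
      then have "N = Suc i" using i by simp
      then show ?thesis
        using dim_w by (simp add: total_weight_def scalar_prod_def ones_vec_def
            atLeast0LessThan lessThan_Suc_atMost)
    qed auto
    finally show "(?Q *\<^sub>v ones_vec N) $ i = (total_weight w \<cdot>\<^sub>v unit_vec N (N - 1)) $ i"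
      using i by simp
  qed simp
  moreover have "(?Q * mat_diag N (\<lambda>k. x $ k) * the (mat_inverse ?Q)) $$ (i, j) \<le> 0"
    if ij: "i < N" "j < N" "i \<noteq> j" for i j
  proof -
    let ?s = "\<lambda>i j. \<Sum>k<N. ?Q $$ (i, k) * (?Q $$ (j, k) * (x $ k / w $ k))"
    have "?s i j \<le> 0"
    proof (cases "i < j")
      case True
      then show ?thesis using weighted_row_product_nonpos[OF pos mono True ij(2)] by simp
    next
      case False
      then have "j < i" using ij by simp
      from weighted_row_product_nonpos[OF pos mono this ij(1)] show ?thesis
        by (simp add: mult.left_commute)
    qed
    then show ?thesis
      using row_norm2_pos[OF pos ij(2)] Q_diag_Q_inverse_index[OF ij(1,2), of w "\<lambda>k. x $ k"]
        mat_inverse_eq_right_inverse[OF Q_matrix_carrier Q_inverse_carrier inv]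
      by (simp add: divide_nonpos_pos)
  qed
  ultimately have "admissible_matrix N x w ?Q"
    by (simp add: admissible_matrix_def Q_matrix_carrier)
  then show ?thesis by (auto simp: admissible_matrices_def)
qed

end
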